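(* Let $N \ge 1$ and let $e : \mathbb{R}^N \to \mathbb{R}$ be a differentiable function (the error function) whose gradient is Lipschitz continuous with constant $L > 0$. Let $h_t \in \mathbb{R}^N$ be hidden activations with error signal $\delta_t = e(h_t)$, let $h_t' = h_t - \alpha \nabla e(h_t)$ be the recoded hidden activations obtained with step size $\alpha = \frac{1}{L}$, and let $\delta_t' = e(h_t')$ be the error signal based on the recoded hidden activations. Then $$\delta_t' \le \delta_t .$$
   Context: $\|\cdot\|$ denotes the Euclidean norm on $\mathbb{R}^N$. The gradient of a differentiable function $e : \mathbb{R}^N \to \mathbb{R}$ is called Lipschitz continuous with constant $L$ if $\|\nabla e(x) - \nabla e(y)\| \le L \|x - y\|$ for all $x, y \in \mathbb{R}^N$. Recoding is the map sending a vector of hidden activations $h_t \in \mathbb{R}^N$ to $h_t' = h_t - \alpha \nabla_{h_t} \delta_t$, where $\alpha$ is the step size and $\delta_t = e(h_t) \in \mathbb{R}$ is the error signal produced from $h_t$ by the error function $e$. *)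

theory Defs
  imports "HOL-Analysis.Analysis"
begin

(* GDERIV is the library's relational gradient; here it is turned into a vector field.
   The value is meaningful only where f is differentiable. *)
definition gradient :: "('a::euclidean_space \<Rightarrow> real) \<Rightarrow> 'a \<Rightarrow> 'a" where
  "gradient f x = (THE D. GDERIV f x :> D)"

definition recode :: "real \<Rightarrow> ('a::euclidean_space \<Rightarrow> real) \<Rightarrow> 'a \<Rightarrow> 'a" where
  "recode \<alpha> e h = h - \<alpha> *\<^sub>R gradient e h"

lemma gradient_eqI:
  fixes f :: "'a::euclidean_space \<Rightarrow> real"
  assumes "GDERIV f x :> D"
  shows "gradient f x = D"
  unfolding gradient_def
proof (rule the_equality)
  show "GDERIV f x :> D" by (fact assms)
next
  fix D' assume "GDERIV f x :> D'"
  with assms have "(\<lambda>h. h \<bullet> D') = (\<lambda>h. h \<bullet> D)"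
    unfolding gderiv_def by (rule has_derivative_unique[rotated])
  then show "D' = D" by (metis vector_eq_rdot inner_commute)
qed

lemma GDERIV_gradient:
  fixes f :: "'a::euclidean_space \<Rightarrow> real"
  assumes "f differentiable (at x)"
  shows "GDERIV f x :> gradient f x"
proof -
  from assms obtain f' where f': "(f has_derivative f') (at x)"
    unfolding differentiable_def by blast
  then interpret bounded_linear f' by (rule has_derivative_bounded_linear)
  have "f' = (\<lambda>h. h \<bullet> adjoint f' 1)"
    using adjoint_works[OF linear_axioms, of _ 1] by auto
  with f' have "GDERIV f x :> adjoint f' 1" unfolding gderiv_def by metis
  then show ?thesis by (simp add: gradient_eqI)
qed

end

(* By the mean value theorem, e (h - \<alpha> g) - e h = - \<alpha> (g \<bullet> \<nabla>e \<xi>) with g = \<nabla>e h and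
   \<xi> = h - t \<alpha> g for some 0 < t < 1. The Lipschitz condition keeps \<nabla>e \<xi> within norm g of g
   when \<alpha> L \<le> 1, so g \<bullet> \<nabla>e \<xi> \<ge> 0. *)

theory Submission
  imports Defs
begin

text \<open>Restricting \<open>f\<close> to the segment from \<open>x\<close> to
  \<open>x + v\<close> reduces this to the one-variable mean value theorem; the chain rule supplies
  the derivative along the segment.\<close>

lemma gradient_mvt:
  fixes f :: "'a::euclidean_space \<Rightarrow> real"
  assumes "\<And>x. f differentiable (at x)"
  obtains t where "0 < t" "t < 1" "f (x + v) - f x = v \<bullet> gradient f (x + t *\<^sub>R v)"
proof -
  have "((\<lambda>t. f (x + t *\<^sub>R v)) has_real_derivative v \<bullet> gradient f (x + t *\<^sub>R v)) (at t)" for t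
  proof -
    have line: "((\<lambda>t. x + t *\<^sub>R v) has_derivative (\<lambda>s. s *\<^sub>R v)) (at t)"
      by (auto intro!: derivative_eq_intros)
    have "(f has_derivative (\<lambda>u. u \<bullet> gradient f (x + t *\<^sub>R v))) (at (x + t *\<^sub>R v))"
      using GDERIV_gradient[OF assms] by (simp add: gderiv_def)
    from has_derivative_compose[OF line this] show ?thesis
      by (simp add: has_field_derivative_def mult_commute_abs)
  qed
  from MVT2[OF zero_less_one this]
  show thesis using that by auto
qed

text \<open>The estimate sees the step size only through its sign and the product
  \<open>\<alpha> * L\<close>, so every short enough step is covered at once.\<close>

lemma recode_le:
  fixes f :: "'a::euclidean_space \<Rightarrow> real"
  assumes diff: "\<And>x. f differentiable (at x)"
    and lip: "L-lipschitz_on UNIV (gradient f)"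
    and "0 \<le> \<alpha>" "\<alpha> * L \<le> 1"
  shows "f (recode \<alpha> f x) \<le> f x"
proof -
  define g where "g = gradient f x"
  obtain t where t: "0 < t" "t < 1"
    and mvt: "f (x + - \<alpha> *\<^sub>R g) - f x = (- \<alpha> *\<^sub>R g) \<bullet> gradient f (x + t *\<^sub>R (- \<alpha> *\<^sub>R g))"
    using gradient_mvt[OF diff] by blast
  define d where "d = gradient f (x + t *\<^sub>R (- \<alpha> *\<^sub>R g))"
  \<comment> \<open>The intermediate point lies at distance \<open>t * \<alpha> * norm g\<close>
    from \<open>x\<close>.\<close>
  have "norm (g - d) \<le> L * (t * \<alpha> * norm g)"
    using lipschitz_onD[OF lip UNIV_I UNIV_I, of x "x + t *\<^sub>R (- \<alpha> *\<^sub>R g)"] t \<open>0 \<le> \<alpha>\<close>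
    by (simp add: dist_norm g_def d_def abs_mult)
  also have "\<dots> = t * (\<alpha> * L) * norm g"
    by simp
  also have "\<dots> \<le> 1 * norm g"
    \<comment> \<open>A Lipschitz constant is nonnegative, so \<open>\<alpha> * L\<close> lies
      between 0 and 1, as does \<open>t\<close>.\<close>
    using t assms(3,4) lipschitz_on_nonneg[OF lip]
    by (intro mult_right_mono mult_le_one[of t "\<alpha> * L"]) simp_all
  \<comment> \<open>Cauchy-Schwarz turns the norm bound into one on the inner product. Expanding its
    left side, the squared norm of \<open>g\<close> cancels and leaves the sign of
    \<open>g \<bullet> d\<close>.\<close>
  finally have "g \<bullet> (g - d) \<le> norm g * norm g"
    using norm_cauchy_schwarz[of g "g - d"] mult_left_mono[of "norm (g - d)" "norm g" "norm g"]
    by simp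
  then have "0 \<le> g \<bullet> d"
    by (simp add: inner_diff_right dot_square_norm power2_eq_square)
  then have "f (x + - \<alpha> *\<^sub>R g) - f x \<le> 0"
    using \<open>0 \<le> \<alpha>\<close> unfolding mvt d_def[symmetric] by simp
  then show ?thesis
    by (simp add: recode_def g_def)
qed

theorem theorem1:
  fixes e :: "real ^ 'n \<Rightarrow> real" and L :: real and h h' :: "real ^ 'n"
    and \<alpha> \<delta> \<delta>' :: real
  assumes "\<And>x. e differentiable (at x)"
    and "L > 0"
    and "L-lipschitz_on UNIV (gradient e)"
    and "\<alpha> = 1 / L"
    and "\<delta> = e h"
    and "h' = recode \<alpha> e h"
    and "\<delta>' = e h'"
  shows "\<delta>' \<le> \<delta>"
  \<comment> \<open>The choice \<open>\<alpha> = 1 / L\<close> is the boundary case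
    \<open>\<alpha> * L = 1\<close>.\<close>
  using recode_le[of e L \<alpha> h] assms by simp

end
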